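(* Let $(F_n)_{n\ge 0}$ be the Fibonacci sequence ($F_0=0$, $F_1=1$, $F_{n+2}=F_{n+1}+F_n$), and for $x\ge 1$ let \[A(x):=\#\{n\le x:\ n \text{ is a positive integer and } n \mid F_n\}.\] Then, as $x\to\infty$, \[\log A(x)\le \log x-\left(\frac12+o(1)\right)\frac{\log x\,\log\log\log x}{\log\log x}.\] That is, there is a function $\varepsilon(x)\to 0$ as $x\to\infty$ such that for all sufficiently large $x$, $A(x)\le x^{1-(1/2+\varepsilon(x))\log\log\log x/\log\log x}$.
   Context: $F_n$ denotes the $n$-th Fibonacci number; $\log$ is the natural logarithm. *)

theory Defs
  imports "HOL-Analysis.Analysis" "HOL-Number_Theory.Fib"
begin

definition fibA :: "real \<Rightarrow> nat" where
  "fibA x = card {n::nat. 1 \<le> n \<and> real n \<le> x \<and> n dvd fib n}"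

end

theory Submission
  imports Defs "HOL-Number_Theory.Number_Theory" "HOL-Computational_Algebra.Squarefree"
    "HOL-Real_Asymp.Real_Asymp"
begin

text \<open>
  Let \<open>n \<le> x\<close> divide \<open>fib n\<close>. Discarding the few \<open>n\<close> with a large square factor, write \<open>n = b * r\<close>
  with \<open>b = x powr o(1)\<close> and \<open>r\<close> squarefree and coprime to \<open>30 * b\<close>. A prime \<open>p \<ge> 7\<close> dividing
  \<open>fib n\<close> already divides \<open>fib d\<close> for some \<open>d\<close> dividing both \<open>n\<close> and \<open>p - 1\<close> or \<open>p + 1\<close>. Hence \<open>n\<close>
  arises from \<open>b\<close> by \<open>O(sqrt (ln x))\<close> steps \<open>k \<mapsto> k * m\<close> with \<open>m\<close> dividing \<open>fib k\<close>. By Rankin's method,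
  each step multiplies the sum of \<open>n powr (a - 1)\<close> by at most \<open>exp (\<Sum>p. p powr (a - 1))\<close>, where \<open>p\<close>
  ranges over the primes \<open>\<ge> 7\<close> dividing \<open>fib k\<close>. Grouping these by \<open>d\<close> bounds the exponent by
  \<open>4 / a * (\<Sum>d | d dvd k. d powr (2 * a - 1))\<close>, which is \<open>ln x powr o(1)\<close> as long as
  \<open>ln x powr (2 * a)\<close> is slightly below \<open>ln (ln x)\<close>. This yields the constant \<open>1/2\<close>.
\<close>

section \<open>Prime divisors of Fibonacci numbers\<close>

text \<open>Binet's formula expanded by the binomial theorem: even powers of \<open>sqrt 5\<close>
  cancel. The resulting identity of naturals can be reduced modulo a prime.\<close>

lemma fib_eq_binomial_sum:
  "2 ^ n * fib n = (\<Sum>k\<le>n. if odd k then 2 * (n choose k) * 5 ^ (k div 2) else 0)"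
proof -
  define s :: real where "s = sqrt 5"
  have s2: "s ^ 2 = 5" and s0: "s \<noteq> 0" by (auto simp: s_def)
  have pow: "s ^ k - (- s) ^ k = s * (if odd k then 2 * 5 ^ (k div 2) else 0)" for k
  proof (cases "odd k")
    case True
    then obtain j where "k = 2 * j + 1" by (auto elim: oddE)
    then show ?thesis by (simp add: power_mult s2)
  qed simp
  have "s * real (2 ^ n * fib n) = (1 + s) ^ n - (1 - s) ^ n"
    using s0 by (simp add: fib_closed_form s_def power_divide field_simps)
  also have "\<dots> = (s + 1) ^ n - (- s + 1) ^ n" by (simp add: add.commute)
  also have "\<dots> = (\<Sum>k\<le>n. real (n choose k) * (s ^ k - (- s) ^ k))"
    unfolding binomial_ring by (simp add: right_diff_distrib flip: sum_subtractf)
  also have "\<dots> = s * real (\<Sum>k\<le>n. if odd k then 2 * (n choose k) * 5 ^ (k div 2) else 0)"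
    unfolding pow of_nat_sum sum_distrib_left by (intro sum.cong) auto
  finally show ?thesis using s0 by (simp only: mult_cancel_left of_nat_eq_iff) blast
qed

text \<open>Modulo \<open>p\<close> only the term \<open>k = p\<close> of the binomial sum survives,
  so \<open>fib p\<close> is congruent to \<open>5 ^ (p div 2)\<close>, whose square is 1 by Fermat.
  As \<open>p - 1\<close> is even, Cassini's identity equates \<open>fib p ^ 2 - 1\<close> with the
  product. Squaring avoids determining a Legendre symbol.\<close>

lemma prime_dvd_fib_neighbours:
  fixes p :: nat
  assumes p: "prime p" "p \<ge> 7"
  shows "p dvd fib (p - 1) * fib (p + 1)"
proof -
  have odd: "odd p" using p prime_odd_nat by force
  have "[(\<Sum>k\<le>p. if odd k then 2 * (p choose k) * 5 ^ (k div 2) else 0)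
       = (\<Sum>k\<le>p. if k = p then 2 * 5 ^ (p div 2) else 0)] (mod p)"
  proof (rule cong_sum)
    fix k assume "k \<in> {..p}"
    then consider "k = p" | "k = 0" | "0 < k" "k < p" by force
    then show "[(if odd k then 2 * (p choose k) * 5 ^ (k div 2) else 0)
       = (if k = p then 2 * 5 ^ (p div 2) else 0)] (mod p)"
    proof cases
      case 3
      then have "p dvd p choose k" using p by (intro dvd_choose_prime) auto
      then show ?thesis using 3 by (auto simp: cong_0_iff)
    qed (use odd p in auto)
  qed
  then have "[2 ^ p * fib p = 2 * 5 ^ (p div 2)] (mod p)"
    by (simp add: fib_eq_binomial_sum[of p])
  then have "[(2 ^ p * fib p) ^ 2 = (2 * 5 ^ (p div 2)) ^ 2] (mod p)" by (rule cong_pow)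
  also have "(2 * 5 ^ (p div 2)) ^ 2 = 4 * (5 :: nat) ^ (p - 1)"
    using odd by (auto simp: power_mult_distrib simp flip: power_mult elim!: oddE)
  also have "[4 * 5 ^ (p - 1) = 4 * 1] (mod p)"
    using p by (intro cong_mult fermat_theorem cong_refl) (auto dest: dvd_imp_le)
  also have "(2 ^ p * fib p) ^ 2 = 4 * ((2 ^ (p - 1)) ^ 2 * fib p ^ 2)"
  proof -
    have "(2::nat) ^ p = 2 * 2 ^ (p - 1)" using p by (cases p) auto
    then show ?thesis by (simp add: power_mult_distrib)
  qed
  finally have "[4 * ((2 ^ (p - 1)) ^ 2 * fib p ^ 2) = 4 * 1] (mod p)" .
  moreover have "coprime 4 p"
    using odd coprime_power_left_iff[of 2 2 p] by (simp add: coprime_commute)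
  ultimately have 1: "[(2 ^ (p - 1)) ^ 2 * fib p ^ 2 = 1] (mod p)"
    using cong_mult_lcancel_nat by blast
  have "[2 ^ (p - 1) = 1] (mod p)"
    using p by (intro fermat_theorem) (auto dest: dvd_imp_le)
  then have "[(2 ^ (p - 1)) ^ 2 * fib p ^ 2 = 1 ^ 2 * fib p ^ 2] (mod p)"
    by (intro cong_mult cong_pow cong_refl)
  then have "[fib p ^ 2 = 1] (mod p)" using 1 by (metis cong_sym cong_trans mult_1 power_one)
  moreover have "fib p > 0" using p by (intro fib_neq_0_nat) auto
  ultimately have "p dvd fib p ^ 2 - 1"
    by (metis cong_altdef_nat cong_sym nat_one_le_power one_le_numeral Suc_leI One_nat_def)
  moreover obtain n where n: "p = Suc n" using p by (cases p) auto
  ultimately show ?thesis using odd fib_Cassini_nat[of n] by (simp add: mult.commute)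
qed

text \<open>Since \<open>fib\<close> commutes with gcd, the gcd of \<open>k\<close> with
  \<open>p - 1\<close> or with \<open>p + 1\<close> serves as \<open>d\<close>.\<close>

lemma prime_dvd_fibE:
  fixes p k :: nat
  assumes "prime p" "p \<ge> 7" "p dvd fib k"
  obtains d where "d dvd k" "p dvd fib d" "d dvd p - 1 \<or> d dvd p + 1"
proof -
  have "p dvd fib (p - 1) \<or> p dvd fib (p + 1)"
    using prime_dvd_fib_neighbours assms by (simp add: prime_dvd_mult_iff)
  then show ?thesis
    using that[of "gcd k (p - 1)"] that[of "gcd k (p + 1)"] assms by (auto simp: fib_gcd)
qed

lemma prod_primes_dvd:
  fixes Q :: "nat set"
  assumes "finite Q" "\<And>q. q \<in> Q \<Longrightarrow> prime q \<and> q dvd n"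
  shows "\<Prod>Q dvd n"
  using assms
proof (induction Q)
  case (insert q Q)
  have "coprime q (\<Prod>Q)"
    using insert by (intro prod_coprime_right) (metis insertCI primes_coprime)
  then show ?case using insert by (simp add: divides_mult)
qed auto

text \<open>Turns the size of a number into a count of its primes; applied to \<open>fib d\<close>,
  to a central binomial coefficient and to an index \<open>k\<close>.\<close>

lemma power_card_primes_le:
  fixes Q :: "nat set"
  assumes "finite Q" "\<And>q. q \<in> Q \<Longrightarrow> prime q \<and> q dvd n \<and> m \<le> q" "n > 0"
  shows "m ^ card Q \<le> n"
proof -
  have "m ^ card Q \<le> \<Prod>Q"
    using assms prod_mono[of Q "\<lambda>_. m" "\<lambda>q. q"] by auto
  also have "\<dots> \<le> n" using assms by (intro dvd_imp_le prod_primes_dvd) auto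
  finally show ?thesis .
qed

lemma fib_le_power2: "fib n \<le> 2 ^ n"
  by (induction n rule: fib.induct) auto

lemma card_primes_dvd_fib_le:
  fixes Q :: "nat set"
  assumes "\<And>q. q \<in> Q \<Longrightarrow> prime q \<and> q dvd fib d" "d > 0"
  shows "finite Q" "card Q \<le> d"
proof -
  have pos: "fib d > 0" using assms(2) by (rule fib_neq_0_nat)
  show fin: "finite Q"
    by (rule finite_subset[of _ "{..fib d}"]) (use assms pos dvd_imp_le in auto)
  have "2 ^ card Q \<le> fib d"
    using assms pos fin by (intro power_card_primes_le) (auto simp: prime_ge_2_nat)
  also have "\<dots> \<le> 2 ^ d" by (rule fib_le_power2)
  finally show "card Q \<le> d" by simp
qed

section \<open>The sum of reciprocals of primes\<close>

text \<open>Chebyshev's argument: with \<open>n = 2 ^ i\<close>, the primes in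
  \<open>(n, 2 n]\<close> all divide the central binomial coefficient, which is at most
  \<open>4 ^ n\<close>, so there are at most \<open>2 n / i\<close> of them.\<close>

lemma sum_inverse_primes_block_le:
  assumes "i > 0"
  shows "(\<Sum>q | prime q \<and> 2 ^ i < q \<and> q \<le> 2 ^ Suc i. 1 / real q) \<le> 2 / real i"
proof -
  define n :: nat where "n = 2 ^ i"
  define Q where "Q = {q. prime q \<and> 2 ^ i < q \<and> q \<le> (2::nat) ^ Suc i}"
  have fin: "finite Q" by (rule finite_subset[of _ "{..2 ^ Suc i}"]) (auto simp: Q_def)
  have dvd: "q dvd (2 * n choose n)" if "q \<in> Q" for q
  proof -
    have q: "prime q" "n < q" "q \<le> 2 * n" using that by (auto simp: Q_def n_def)
    have "fact n * fact n * (2 * n choose n) = (fact (2 * n) :: nat)"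
      using binomial_fact_lemma[of n "2 * n"] by simp
    moreover have "q dvd fact (2 * n)" "\<not> q dvd fact n"
      using q by (auto simp: prime_dvd_fact_iff)
    ultimately show ?thesis using q(1) by (metis prime_dvd_mult_iff)
  qed
  have "n ^ card Q \<le> (2 * n choose n)"
    using fin dvd by (intro power_card_primes_le) (auto simp: Q_def n_def)
  also have "\<dots> \<le> 2 ^ (2 * n)" by (rule binomial_le_pow2)
  finally have "2 ^ (i * card Q) \<le> (2::nat) ^ (2 * n)" by (simp add: n_def power_mult)
  then have le: "i * card Q \<le> 2 * n" by simp
  have "(\<Sum>q\<in>Q. 1 / real q) \<le> real (card Q) * (1 / real n)"
  proof (rule sum_bounded_above)
    fix q assume "q \<in> Q"
    then have "n < q" "0 < n" by (auto simp: Q_def n_def)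
    then show "1 / real q \<le> 1 / real n" by (simp add: frac_le)
  qed
  also have "\<dots> \<le> 2 / real i"
  proof -
    have "real i * real (card Q) \<le> 2 * real n"
      using le by (metis of_nat_le_iff of_nat_mult of_nat_numeral)
    moreover have "n > 0" by (simp add: n_def)
    ultimately show ?thesis using assms by (simp add: field_simps)
  qed
  finally show ?thesis by (simp add: Q_def)
qed

text \<open>A weak form of Mertens' theorem: the dyadic blocks contribute a harmonic sum. Only the
  doubly logarithmic growth matters later, not the constants.\<close>

lemma sum_inverse_primes_le:
  assumes "J > 0"
  shows "(\<Sum>q | prime q \<and> q \<le> (2::nat) ^ J. 1 / real q) \<le> 5/2 + 2 * ln (real J)"
proof -
  define S where "S J = (\<Sum>q | prime q \<and> q \<le> (2::nat) ^ J. 1 / real q)" for J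
  have Suc: "S (Suc J) \<le> S J + 2 / real J" if "J > 0" for J
  proof -
    have eq: "{q. prime q \<and> q \<le> (2::nat) ^ Suc J} =
       {q. prime q \<and> q \<le> 2 ^ J} \<union> {q. prime q \<and> 2 ^ J < q \<and> q \<le> 2 ^ Suc J}"
      by (auto simp: not_le)
    have "S (Suc J) = S J + (\<Sum>q | prime q \<and> 2 ^ J < q \<and> q \<le> (2::nat) ^ Suc J. 1 / real q)"
      unfolding S_def eq by (intro sum.union_disjoint) 
        (auto intro: finite_subset[of _ "{..2 ^ J}"] finite_subset[of _ "{..2 ^ Suc J}"])
    then show ?thesis using sum_inverse_primes_block_le[OF that] by linarith
  qed
  have "{q. prime q \<and> q \<le> (2::nat)} = {2}" using prime_ge_2_nat by (auto simp: le_antisym)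
  then have S1: "S 1 = 1/2" by (simp add: S_def)
  \<comment> \<open>The block for \<open>J = 1\<close> adds \<open>2\<close> to
    \<open>S 1 = 1/2\<close>, whence \<open>5/2\<close>; each later block is absorbed by
    \<open>ln (J + 1) - ln J\<close>, which is at least \<open>1 / (J + 1)\<close>.\<close>
  have SS: "S (Suc J) \<le> 5/2 + 2 * ln (real J)" if "J \<ge> 1" for J
    using that
  proof (induction J rule: dec_induct)
    case base
    then show ?case using Suc[of 1] S1 by simp
  next
    case (step J)
    have "ln (real J / real (Suc J)) \<le> real J / real (Suc J) - 1"
      using step by (intro ln_le_minus_one) auto
    also have "\<dots> = - (1 / real (Suc J))" by (simp add: field_simps)
    finally have "ln (real J) + 1 / real (Suc J) \<le> ln (real (Suc J))"
      using step by (simp add: ln_div)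
    moreover have "2 / real (Suc J) = 2 * (1 / real (Suc J))" by simp
    ultimately show ?case using step.IH Suc[of "Suc J"] by linarith
  qed
  show ?thesis
  proof (cases "J = 1")
    case True
    then show ?thesis using S1 by (simp add: S_def)
  next
    case False
    then obtain j where j: "J = Suc j" "j \<ge> 1" using assms by (cases J) auto
    then have "ln (real j) \<le> ln (real J)" by simp
    moreover have "S J \<le> 5/2 + 2 * ln (real j)" using SS[of j] j by simp
    ultimately show ?thesis unfolding S_def by linarith
  qed
qed

section \<open>Towers of divisors of Fibonacci numbers\<close>

text \<open>Such an \<open>m\<close> is determined by its set of prime divisors, all at least 7, so
  that sums over cofactors are dominated by an Euler product.\<close>

definition fib_cofactors :: "nat \<Rightarrow> nat set" where
  "fib_cofactors k = {m. squarefree m \<and> coprime m 30 \<and> m dvd fib k}"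

text \<open>The numbers reached from \<open>b\<close> in \<open>t\<close> steps. A product may arise
  in several ways; upper bounds tolerate this.\<close>

fun fib_tower :: "nat \<Rightarrow> nat \<Rightarrow> nat set" where
  "fib_tower b 0 = {b}"
| "fib_tower b (Suc t) = (\<Union>k\<in>fib_tower b t. (\<lambda>m. k * m) ` fib_cofactors k)"

lemma fib_dvd_fib:
  assumes "d dvd n"
  shows "fib d dvd fib n"
proof -
  have "fib d = gcd (fib d) (fib n)"
    using fib_gcd[of d n] by (simp only: gcd_nat.absorb1[OF assms])
  then show ?thesis by (metis gcd_dvd2)
qed

lemma prime_coprime_30_ge_7:
  fixes p r :: nat
  assumes "prime p" "p dvd r" "coprime r 30"
  shows "p \<ge> 7"
proof (rule ccontr)
  assume "\<not> p \<ge> 7"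
  then have "p < 7" by simp
  then have "p \<in> {0, 1, 2, 3, 4, 5, 6}" by auto
  moreover have "\<not> prime (4 :: nat)" "\<not> prime (6 :: nat)" by (simp_all add: prime_nat_numeral_eq)
  ultimately have "p \<in> {2, 3, 5}" using assms(1) by auto
  then have "p dvd 30" by auto
  then show False using assms by (meson coprime_common_divisor not_prime_unit)
qed

lemma squarefree_eq_prod_prime_factors:
  assumes "squarefree (r :: nat)"
  shows "r = \<Prod>(prime_factors r)"
proof -
  have "r \<noteq> 0" using assms by (metis not_squarefree_0)
  then have "r = (\<Prod>p\<in>prime_factors r. p ^ multiplicity p r)"
    by (simp add: prod_prime_factors)
  also have "\<dots> = \<Prod>(prime_factors r)"
    using assms \<open>r \<noteq> 0\<close> by (intro prod.cong) (auto simp: squarefree_factorial_semiring')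
  finally show ?thesis .
qed

text \<open>
  If a prime \<open>p\<close> divides \<open>fib (b * r)\<close>, then only primes up to \<open>(p + 1) / 2\<close> are needed in the
  index. Peeling off the primes of \<open>r\<close> above half of the largest one thus descends one level,
  and since the largest prime halves each time, the height \<open>t\<close> is at most of order
  \<open>sqrt (ln r)\<close>.
\<close>
lemma mem_fib_tower:
  fixes b r :: nat
  assumes "b > 0" "squarefree r" "coprime r b" "coprime r 30"
    and "\<And>p. prime p \<Longrightarrow> p dvd r \<Longrightarrow> p dvd fib (b * r)"
  shows "\<exists>t. b * r \<in> fib_tower b t \<and> 2 ^ (t\<^sup>2) \<le> r\<^sup>2 \<and> (t = 0 \<or> (\<exists>p. prime p \<and> p dvd r \<and> 2 ^ t < p))"
  using assms(2-)
proof (induction r rule: less_induct)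
  case (less r)
  note sf = less.prems(1) and cob = less.prems(2) and co30 = less.prems(3) and fibr = less.prems(4)
  have r0: "r > 0" using sf by (metis not_gr0 not_squarefree_0)
  show ?case
  proof (cases "r = 1")
    case True
    then show ?thesis by (intro exI[of _ 0]) auto
  next
    case False
    define P where "P = Max (prime_factors r)"
    have ne: "prime_factors r \<noteq> {}" using False r0 by (auto simp: prime_factorization_empty_iff)
    then have "P \<in> prime_factors r" by (simp add: P_def)
    then have P: "prime P" "P dvd r" by auto
    have P7: "P \<ge> 7" using P co30 prime_coprime_30_ge_7 by blast
    have Pmax: "p \<le> P" if "prime p" "p dvd r" for p
      using that r0 by (auto simp: P_def prime_factors_dvd intro!: Max_ge)
    define A where "A = {p \<in> prime_factors r. 2 * p > P + 1}"
    define B where "B = {p \<in> prime_factors r. 2 * p \<le> P + 1}"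
    define m where "m = \<Prod>A"
    define r' where "r' = \<Prod>B"
    have fin: "finite A" "finite B" by (auto simp: A_def B_def)
    have "prime_factors r = B \<union> A" "B \<inter> A = {}" by (auto simp: A_def B_def)
    then have r: "r = r' * m"
      unfolding r'_def m_def using squarefree_eq_prod_prime_factors[OF sf] fin
      by (metis prod.union_disjoint)
    have "P \<in> A" using P P7 r0 by (auto simp: A_def prime_factors_dvd)
    then have Pm: "P dvd m" using fin by (auto simp: m_def)
    have m0: "m > 0" "r' > 0" using r r0 by auto
    have primeB: "2 * p \<le> P + 1" if p: "prime p" "p dvd r'" for p
    proof -
      obtain q where "q \<in> B" "p dvd q"
        using p prime_dvd_prod_iff[of B p "\<lambda>q. q"] fin by (auto simp: r'_def)
      then show ?thesis using that by (auto simp: B_def dest: primes_dvd_imp_eq)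
    qed
    have primeA: "2 * p > P + 1" if p: "prime p" "p dvd m" for p
    proof -
      obtain q where "q \<in> A" "p dvd q"
        using p prime_dvd_prod_iff[of A p "\<lambda>q. q"] fin by (auto simp: m_def)
      then show ?thesis using that by (auto simp: A_def dest: primes_dvd_imp_eq)
    qed
    \<comment> \<open>Proved for all primes of \<open>r\<close>: for those in \<open>A\<close> it
      makes \<open>m\<close> a cofactor of \<open>b * r'\<close>, for those in \<open>B\<close> it
      is the premise of the induction hypothesis.\<close>
    have fibr': "p dvd fib (b * r')" if p: "prime p" "p dvd r" for p
    proof -
      have p7: "p \<ge> 7" using p co30 prime_coprime_30_ge_7 by blast
      obtain d where d: "d dvd b * r" "p dvd fib d" "d dvd p - 1 \<or> d dvd p + 1"
        using prime_dvd_fibE[OF p(1) p7 fibr[OF p]] by blast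
      \<comment> \<open>A common prime \<open>q\<close> is odd and divides the even number
        \<open>p - 1\<close> or \<open>p + 1\<close>, so
        \<open>2 * q \<le> p + 1 \<le> P + 1\<close>, which is excluded for primes of
        \<open>m\<close>.\<close>
      have "coprime d m"
      proof (rule ccontr)
        assume "\<not> coprime d m"
        then obtain q where q: "prime q" "q dvd d" "q dvd m"
          by (metis coprime_iff_gcd_eq_1 gcd_greatest_iff prime_factor_nat)
        have "q \<ge> 7" using q co30 r prime_coprime_30_ge_7 by (metis dvd_mult)
        then have "odd q" using q(1) prime_odd_nat by force
        have "odd p" using p p7 prime_odd_nat by force
        define e where "e = (if d dvd p - 1 then p - 1 else p + 1)"
        have e: "q dvd e" "2 dvd e" "e > 0" "e \<le> p + 1"
          using d(3) q(2) \<open>odd p\<close> p7 by (auto simp: e_def intro: dvd_trans)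
        then have "2 * q dvd e" using \<open>odd q\<close> by (intro divides_mult) auto
        then have "2 * q \<le> p + 1" using e dvd_imp_le[of "2 * q" e] by linarith
        then show False using primeA[OF q(1,3)] Pmax[OF p] by linarith
      qed
      then have "d dvd b * r'"
        using d(1) r by (metis coprime_dvd_mult_left_iff mult.assoc)
      then show ?thesis using d(2) fib_dvd_fib by (meson dvd_trans)
    qed
    have mcof: "m \<in> fib_cofactors (b * r')"
    proof -
      have "m dvd fib (b * r')" unfolding m_def
        using fin fibr' by (intro prod_primes_dvd) (auto simp: A_def)
      moreover have "squarefree m" using sf r by (metis squarefree_multD(2))
      moreover have "coprime m 30" using co30 r by simp
      ultimately show ?thesis by (simp add: fib_cofactors_def)
    qed
    have "P \<le> m" using Pm m0 by (simp add: dvd_imp_le)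
    then have "r' < r" using r m0 P7 by auto
    moreover have "squarefree r'" using sf r by (metis squarefree_multD(1))
    moreover have "coprime r' b" "coprime r' 30" using cob co30 r by simp_all
    moreover have "p dvd fib (b * r')" if "prime p" "p dvd r'" for p
      using fibr' that r by simp
    ultimately obtain t where t: "b * r' \<in> fib_tower b t" "2 ^ (t\<^sup>2) \<le> r'\<^sup>2"
        "t = 0 \<or> (\<exists>p. prime p \<and> p dvd r' \<and> 2 ^ t < p)"
      using less.IH by blast
    \<comment> \<open>The last conjunct of the claim is carried for this: \<open>2 ^ t < p\<close>
      and \<open>2 * p \<le> P + 1\<close> double the bound, strictness paying for the
      \<open>+ 1\<close>. At height 0, \<open>P \<ge> 7\<close> suffices.\<close>
    have tP: "2 ^ Suc t < P"
      using t(3)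
    proof
      assume "\<exists>p. prime p \<and> p dvd r' \<and> 2 ^ t < p"
      then obtain p where "prime p" "p dvd r'" "2 ^ t < p" by blast
      then show ?thesis using primeB[of p] by simp
    qed (use P7 in simp)
    have "b * r \<in> fib_tower b (Suc t)"
      using t(1) mcof r by (auto simp: mult.assoc intro!: bexI[of _ "b * r'"])
    \<comment> \<open>Going from \<open>t\<close> to \<open>t + 1\<close> raises the exponent by
      \<open>2 * t + 1\<close>, which a factor \<open>(2 ^ Suc t)\<^sup>2 \<le> m\<^sup>2\<close>
      covers; hence the square of \<open>r\<close> in the claim.\<close>
    moreover have "2 ^ ((Suc t)\<^sup>2) \<le> r\<^sup>2"
    proof -
      have "(2::nat) ^ ((Suc t)\<^sup>2) \<le> 2 ^ (t\<^sup>2 + 2 * Suc t)"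
        by (intro power_increasing) (auto simp: power2_eq_square)
      also have "\<dots> = 2 ^ (t\<^sup>2) * (2 ^ Suc t)\<^sup>2"
        by (simp only: power_add power_mult[symmetric] mult.commute)
      also have "\<dots> \<le> r'\<^sup>2 * m\<^sup>2"
        using t(2) tP \<open>P \<le> m\<close> by (intro mult_mono power_mono) auto
      also have "\<dots> = r\<^sup>2" by (simp add: r power_mult_distrib)
      finally show ?thesis .
    qed
    ultimately show ?thesis using tP P by blast
  qed
qed

text \<open>With \<open>n = u * v\<^sup>2\<close> and \<open>u\<close> squarefree, the base
  \<open>b\<close> absorbs \<open>v\<^sup>2\<close> and the part \<open>g\<close> of
  \<open>u\<close> shared with \<open>30 * v\<close>. What remains is squarefree and coprime to
  \<open>b\<close> and 30, and \<open>g \<le> 30 * v\<close> gives the cubic bound.\<close>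

lemma self_fib_divisor_mem_tower:
  fixes n :: nat
  assumes "n > 0" "n dvd fib n"
  obtains b t where "b > 0" "b \<le> 30 * square_part n ^ 3" "n \<in> fib_tower b t" "2 ^ (t\<^sup>2) \<le> n\<^sup>2"
proof -
  define u v where "u = squarefree_part n" and "v = square_part n"
  have n: "n = u * v\<^sup>2" and u: "squarefree u" and v0: "v > 0"
    using assms squarefree_decompose[of n] square_part_0_iff[of n]
    unfolding u_def v_def by (auto intro: Nat.gr0I simp del: square_part_0_iff)
  define g where "g = gcd u (30 * v)"
  define r b where "r = u div g" and "b = v\<^sup>2 * g"
  have ur: "u = g * r" by (simp add: g_def r_def)
  have g0: "g > 0" using v0 by (simp add: g_def)
  have nbr: "n = b * r" by (simp add: n b_def ur)
  have sf: "squarefree r" using u ur by (metis squarefree_multD(2))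
  \<comment> \<open>Such a prime would divide both \<open>g\<close> and \<open>r\<close>, so its
    square would divide the squarefree \<open>u\<close>.\<close>
  have nd: "\<not> p dvd 30 * v" if "prime p" "p dvd r" for p
  proof
    assume "p dvd 30 * v"
    moreover have "p dvd u" using that by (simp add: ur)
    ultimately have "p dvd g" by (simp add: g_def)
    then have "p ^ 2 dvd u" using that ur by (simp add: power2_eq_square mult_dvd_mono)
    then show False using squarefreeD[OF u] that(1) by (metis not_prime_unit)
  qed
  have cop: "coprime r (30 * v)"
    using nd by (metis coprime_iff_gcd_eq_1 gcd_greatest_iff prime_factor_nat)
  then have "coprime r g" unfolding g_def by (metis coprime_divisors dvd_refl gcd_dvd2)
  then have "coprime r b" "coprime r 30" using cop by (auto simp: b_def)
  moreover have "b > 0" using v0 g0 by (simp add: b_def)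
  moreover have "p dvd fib (b * r)" if "prime p" "p dvd r" for p
    using assms(2) that nbr by (metis dvd_mult dvd_trans)
  ultimately obtain t where t: "b * r \<in> fib_tower b t" "2 ^ (t\<^sup>2) \<le> r\<^sup>2"
    using mem_fib_tower[of b r] sf by blast
  have "g \<le> 30 * v" using v0 by (auto simp: g_def intro!: dvd_imp_le)
  then have "b \<le> v\<^sup>2 * (30 * v)" by (simp add: b_def)
  then have "b \<le> 30 * square_part n ^ 3"
    by (simp add: v_def power2_eq_square power3_eq_cube mult_ac)
  moreover have "r\<^sup>2 \<le> n\<^sup>2" using \<open>b > 0\<close> by (intro power_mono) (auto simp: nbr)
  then have "2 ^ (t\<^sup>2) \<le> n\<^sup>2" using t(2) by linarith
  moreover have "n \<in> fib_tower b t" using t(1) nbr by simp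
  ultimately show ?thesis using that \<open>b > 0\<close> by blast
qed

lemma one_mem_fib_cofactors: "1 \<in> fib_cofactors k"
  by (simp add: fib_cofactors_def)

text \<open>Multiplying by the cofactor 1 pads a tower, so that all heights can be replaced by one
  common height.\<close>

lemma fib_tower_mono:
  assumes "s \<le> t"
  shows "fib_tower b s \<subseteq> fib_tower b t"
  using assms
proof (rule lift_Suc_mono_le[rotated])
  show "fib_tower b n \<subseteq> fib_tower b (Suc n)" for n
  proof
    fix k assume "k \<in> fib_tower b n"
    moreover have "k \<in> (\<lambda>m. k * m) ` fib_cofactors k"
      using one_mem_fib_cofactors by (intro image_eqI[of _ _ 1]) auto
    ultimately show "k \<in> fib_tower b (Suc n)" by auto
  qed
qed

lemma finite_fib_cofactors:
  assumes "k > 0"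
  shows "finite (fib_cofactors k)"
  using fib_neq_0_nat[OF assms]
  by (intro finite_subset[of "fib_cofactors k" "{..fib k}"]) (auto simp: fib_cofactors_def dvd_imp_le)

lemma fib_cofactors_pos: "m \<in> fib_cofactors k \<Longrightarrow> m > 0"
  by (cases "m = 0") (auto simp: fib_cofactors_def)

lemma fib_tower_pos: "b > 0 \<Longrightarrow> n \<in> fib_tower b t \<Longrightarrow> n > 0"
proof (induction t arbitrary: n)
  case (Suc t)
  then show ?case using fib_cofactors_pos by fastforce
qed simp

section \<open>Rankin sums over cofactors and towers\<close>

text \<open>Cofactors correspond to subsets of \<open>Q\<close>, so the sum is at most the Euler
  product of \<open>1 + p powr - c\<close>, and \<open>1 + y \<le> exp y\<close>.\<close>

lemma sum_fib_cofactors_le: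
  fixes c :: real
  assumes "k > 0"
  shows "(\<Sum>m\<in>fib_cofactors k. real m powr - c) \<le>
    exp (\<Sum>p | prime p \<and> 7 \<le> p \<and> p dvd fib k. real p powr - c)"
proof -
  define Q where "Q = {p. prime p \<and> 7 \<le> p \<and> p dvd fib k}"
  define f where "f p = real p powr - c" for p
  have fin: "finite Q" using assms by (intro card_primes_dvd_fib_le(1)[of Q k]) (auto simp: Q_def)
  have inj: "inj_on prime_factors (fib_cofactors k)"
    by (rule inj_onI) (metis fib_cofactors_def mem_Collect_eq squarefree_eq_prod_prime_factors)
  have sub: "prime_factors ` fib_cofactors k \<subseteq> Pow Q"
    using prime_coprime_30_ge_7
    by (auto simp: Q_def fib_cofactors_def in_prime_factors_iff intro: dvd_trans)
  have eq: "f m = (\<Prod>p\<in>prime_factors m. f p)" if "m \<in> fib_cofactors k" for m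
  proof -
    have "f m = real (\<Prod>(prime_factors m)) powr - c"
      using that squarefree_eq_prod_prime_factors[of m] by (simp add: f_def fib_cofactors_def)
    then show ?thesis by (simp add: f_def prod_powr_distrib)
  qed
  have "(\<Sum>m\<in>fib_cofactors k. f m) = (\<Sum>X\<in>prime_factors ` fib_cofactors k. prod f X)"
    using inj eq by (simp add: sum.reindex)
  also have "\<dots> \<le> (\<Sum>X\<in>Pow Q. prod f X)"
    using fin sub by (intro sum_mono2) (auto simp: f_def intro!: prod_nonneg)
  also have "\<dots> = (\<Prod>p\<in>Q. f p + 1)" using prod_add[OF fin, of f "\<lambda>_. 1"] by simp
  also have "\<dots> \<le> (\<Prod>p\<in>Q. exp (f p))"
    by (intro prod_mono) (auto simp: f_def add.commute)
  also have "\<dots> = exp (\<Sum>p\<in>Q. f p)" using fin by (simp add: exp_sum)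
  finally show ?thesis by (simp add: f_def Q_def)
qed

lemma sum_image_nonneg_le:
  fixes f :: "'b \<Rightarrow> real"
  assumes "finite A" "\<And>y. f y \<ge> 0" "B \<subseteq> g ` A"
  shows "sum f B \<le> (\<Sum>x\<in>A. f (g x))"
proof -
  have "sum f B \<le> sum f (g ` A)" using assms by (intro sum_mono2) auto
  also have "\<dots> \<le> sum (f \<circ> g) A" using assms by (intro sum_image_le) auto
  finally show ?thesis by simp
qed

text \<open>Each step costs one factor \<open>E\<close>. Cofactors are positive, so
  \<open>k \<le> k * m \<le> N\<close>: the cutoff passes down to the previous level, where the
  bound \<open>E\<close> applies.\<close>

lemma sum_fib_tower_le:
  fixes c E :: real
  assumes "b > 0" "E \<ge> 0"
    and E: "\<And>k. k > 0 \<Longrightarrow> k \<le> N \<Longrightarrow> (\<Sum>m\<in>fib_cofactors k. real m powr - c) \<le> E"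
  shows "(\<Sum>n | n \<in> fib_tower b t \<and> n \<le> N. real n powr - c) \<le> real b powr - c * E ^ t"
proof (induction t)
  case 0
  have "(\<Sum>n | n = b \<and> n \<le> N. real n powr - c) \<le> (\<Sum>n\<in>{b}. real n powr - c)"
    by (intro sum_mono2) auto
  then show ?case by simp
next
  case (Suc t)
  define K where "K = {k. k \<in> fib_tower b t \<and> k \<le> N}"
  define S where "S = Sigma K fib_cofactors"
  have K0: "k > 0" "k \<le> N" if "k \<in> K" for k
    using that fib_tower_pos assms(1) by (auto simp: K_def)
  have finK: "finite K" by (rule finite_subset[of _ "{..N}"]) (auto simp: K_def)
  have finS: "finite S" using finK K0 finite_fib_cofactors by (auto simp: S_def)
  have sub: "{n. n \<in> fib_tower b (Suc t) \<and> n \<le> N} \<subseteq> (\<lambda>(k, m). k * m) ` S"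
  proof
    fix n assume "n \<in> {n. n \<in> fib_tower b (Suc t) \<and> n \<le> N}"
    then obtain k m where km: "k \<in> fib_tower b t" "m \<in> fib_cofactors k" "n = k * m" "n \<le> N" by auto
    have "k * 1 \<le> k * m" using fib_cofactors_pos[OF km(2)] by (intro mult_le_mono2) simp
    then have "k \<le> N" using km by linarith
    then have "(k, m) \<in> S" using km by (simp add: S_def K_def)
    then show "n \<in> (\<lambda>(k, m). k * m) ` S" using km by (intro image_eqI[of _ _ "(k, m)"]) auto
  qed
  have "(\<Sum>n | n \<in> fib_tower b (Suc t) \<and> n \<le> N. real n powr - c)
      \<le> (\<Sum>z\<in>S. real (case z of (k, m) \<Rightarrow> k * m) powr - c)"
    using finS sub by (intro sum_image_nonneg_le) auto
  also have "\<dots> = (\<Sum>k\<in>K. \<Sum>m\<in>fib_cofactors k. real k powr - c * real m powr - c)"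
    unfolding S_def using finK K0 finite_fib_cofactors
    by (subst sum.Sigma) (auto simp: powr_mult intro!: sum.cong)
  also have "\<dots> \<le> (\<Sum>k\<in>K. real k powr - c * E)"
    unfolding sum_distrib_left[symmetric] using K0 E by (intro sum_mono mult_left_mono) auto
  also have "\<dots> = (\<Sum>k\<in>K. real k powr - c) * E" by (simp add: sum_distrib_right)
  also have "\<dots> \<le> real b powr - c * E ^ t * E"
    using Suc.IH \<open>E \<ge> 0\<close> by (intro mult_right_mono) (auto simp: K_def)
  finally show ?case by (simp add: mult_ac)
qed

section \<open>The Rankin bound for one step\<close>

text \<open>Discrete comparison with the integral of \<open>t powr (a - 1)\<close>. One increment
  amounts to \<open>u powr a \<le> a * u + 1 - a\<close> for \<open>u = n / (n + 1)\<close>, an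
  instance of Young's inequality.\<close>

lemma sum_powr_minus_le:
  fixes a :: real
  assumes "0 < a" "a \<le> 1"
  shows "(\<Sum>j=1..n. real j powr (a - 1)) \<le> real n powr a / a"
proof (induction n)
  case (Suc n)
  have "real n powr a / a + real (Suc n) powr (a - 1) \<le> real (Suc n) powr a / a"
  proof (cases "n = 0")
    case True
    then show ?thesis using assms by simp
  next
    case False
    define u where "u = real n / real (Suc n)"
    have u: "u > 0" "u = 1 - 1 / real (Suc n)" using False by (auto simp: u_def field_simps)
    have "u powr a * 1 powr (1 - a) \<le> a * u + (1 - a) * 1"
      using assms u by (intro Youngs_inequality_0) auto
    then have "u powr a \<le> 1 - a / real (Suc n)" by (simp add: u(2) right_diff_distrib)
    then have "u powr a * real (Suc n) powr a \<le> (1 - a / real (Suc n)) * real (Suc n) powr a"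
      by (rule mult_right_mono) simp
    moreover have "u powr a * real (Suc n) powr a = real n powr a"
      by (simp add: u_def powr_divide)
    moreover have "real (Suc n) powr (a - 1) = real (Suc n) powr a / real (Suc n)"
      by (simp add: powr_diff)
    ultimately have "real n powr a \<le> real (Suc n) powr a - a * real (Suc n) powr (a - 1)"
      by (simp add: left_diff_distrib)
    then have "real n powr a / a \<le> (real (Suc n) powr a - a * real (Suc n) powr (a - 1)) / a"
      using assms by (intro divide_right_mono) auto
    then show ?thesis using assms by (simp add: diff_divide_distrib)
  qed
  then show ?case using Suc by simp
qed simp

text \<open>
  There are at most \<open>d\<close> such primes, all congruent to \<open>\<plusminus>1\<close> modulo \<open>d\<close>, so the sum is largest if
  they are as small as this allows, that is, if they fill the range up to \<open>d\<^sup>2\<close>.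
\<close>
lemma sum_primitive_primes_le:
  fixes a :: real
  assumes a: "0 < a" "a \<le> 1" and d: "d > 0"
  shows "(\<Sum>p | prime p \<and> 7 \<le> p \<and> p dvd fib d \<and> (d dvd p - 1 \<or> d dvd p + 1). real p powr (a - 1))
    \<le> 4 / a * real d powr (2 * a - 1)"
proof -
  define Q where "Q = {p. prime p \<and> 7 \<le> p \<and> p dvd fib d \<and> (d dvd p - 1 \<or> d dvd p + 1)}"
  define f where "f p = real p powr (a - 1)" for p
  define L U where "L = {p \<in> Q. p < d\<^sup>2}" and "U = {p \<in> Q. d\<^sup>2 \<le> p}"
  have finQ: "finite Q" and cardQ: "card Q \<le> d"
    using card_primes_dvd_fib_le[of Q d] d by (auto simp: Q_def)
  have "sum f Q = sum f (L \<union> U)" by (rule arg_cong[where f = "sum f"]) (auto simp: L_def U_def)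
  also have "\<dots> = sum f L + sum f U"
    using finQ by (intro sum.union_disjoint) (auto simp: L_def U_def)
  finally have split: "sum f Q = sum f L + sum f U" .
  have "sum f U \<le> real (card U) * real (d\<^sup>2) powr (a - 1)"
  proof (rule sum_bounded_above)
    fix p assume "p \<in> U"
    then show "f p \<le> real (d\<^sup>2) powr (a - 1)"
      unfolding f_def using a d by (intro powr_mono2') (auto simp: U_def simp del: of_nat_power)
  qed
  also have "\<dots> \<le> real d * real (d\<^sup>2) powr (a - 1)"
    using cardQ finQ by (intro mult_right_mono) (auto simp: U_def intro: order_trans[OF card_mono])
  also have "\<dots> = real d powr (2 * a - 1)"
  proof -
    have eq: "real (d\<^sup>2) = real d powr 2" using d by simp
    have "real d * real (d\<^sup>2) powr (a - 1) = real d powr 1 * real d powr (2 * (a - 1))"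
      unfolding eq powr_powr using d by simp
    also have "\<dots> = real d powr (1 + 2 * (a - 1))" by (simp only: powr_add)
    finally show ?thesis by (simp add: algebra_simps)
  qed
  also have "\<dots> \<le> 1 / a * real d powr (2 * a - 1)"
    using a mult_right_mono[of 1 "1 / a" "real d powr (2 * a - 1)"] by simp
  finally have U: "sum f U \<le> 1 / a * real d powr (2 * a - 1)" .
  \<comment> \<open>Candidates below \<open>d\<^sup>2\<close>, the Boolean choosing the sign. Here
    \<open>j = d\<close> can occur only with the minus sign, and \<open>7 \<le> p\<close> excludes
    \<open>j = 0\<close>.\<close>
  define g where "g = (\<lambda>(j, s). if s then j * d - 1 else j * d + 1)"
  have "L \<subseteq> g ` ({1..d} \<times> UNIV)"
  proof
    fix p assume "p \<in> L"
    then have p: "7 \<le> p" "p < d\<^sup>2" "d dvd p - 1 \<or> d dvd p + 1" by (auto simp: L_def Q_def)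
    from p(3) show "p \<in> g ` ({1..d} \<times> UNIV)"
    proof
      assume "d dvd p - 1"
      then obtain j where j: "p - 1 = j * d" by (auto simp: dvd_def mult.commute)
      then have "p = j * d + 1" using p by linarith
      moreover from this have "j \<noteq> 0" using p by (intro notI) simp
      moreover have "j * d < d * d" using p j unfolding power2_eq_square by linarith
      ultimately show ?thesis by (intro image_eqI[of _ _ "(j, False)"]) (auto simp: g_def)
    next
      assume "d dvd p + 1"
      then obtain j where j: "p + 1 = j * d" by (auto simp: dvd_def mult.commute)
      then have "p = j * d - 1" by linarith
      moreover have "j \<noteq> 0" using j by (intro notI) simp
      moreover have "j * d \<le> d * d" using p j unfolding power2_eq_square by linarith
      ultimately show ?thesis using d by (intro image_eqI[of _ _ "(j, True)"]) (auto simp: g_def)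
    qed
  qed
  then have "sum f L \<le> (\<Sum>z\<in>{1..d} \<times> UNIV. f (g z))"
    by (intro sum_image_nonneg_le) (auto simp: f_def)
  also have "\<dots> = (\<Sum>j=1..d. \<Sum>s\<in>UNIV. f (g (j, s)))"
    by (simp add: sum.cartesian_product)
  \<comment> \<open>The constant is \<open>1 + 2\<close>: \<open>w + 1\<close> costs at most
    \<open>f w\<close>, and \<open>w - 1 \<ge> w / 2\<close> at most
    \<open>2 powr (1 - a) * f w\<close>.\<close>
  also have "\<dots> \<le> (\<Sum>j=1..d. 3 * (real d powr (a - 1) * real j powr (a - 1)))"
  proof (rule sum_mono)
    fix j assume "j \<in> {1..d}"
    then have j: "j \<ge> 1" by simp
    define w where "w = j * d"
    have w: "w \<ge> 1" using j d by (simp add: w_def)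
    have "f (w + 1) \<le> f w" unfolding f_def using a w by (intro powr_mono2') auto
    moreover have "f (w - 1) \<le> 2 * f w"
    \<comment> \<open>For \<open>w = 1\<close> the left side is \<open>0 powr (a - 1)\<close>, which
      is 0 by convention.\<close>
    proof (cases "w = 1")
      case False
      then have "f (w - 1) \<le> (real w / 2) powr (a - 1)"
        unfolding f_def using a w by (intro powr_mono2') auto
      also have "\<dots> = f w * 2 powr (1 - a)"
        by (simp add: f_def powr_divide powr_diff)
      also have "\<dots> \<le> f w * 2 powr 1"
        using a by (intro mult_left_mono powr_mono) (auto simp: f_def)
      finally show ?thesis by simp
    qed (simp add: f_def)
    moreover have "f w = real d powr (a - 1) * real j powr (a - 1)"
      by (simp add: f_def w_def powr_mult)
    ultimately show "(\<Sum>s\<in>UNIV. f (g (j, s))) \<le> 3 * (real d powr (a - 1) * real j powr (a - 1))"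
      by (simp add: UNIV_bool g_def w_def)
  qed
  also have "\<dots> = 3 * real d powr (a - 1) * (\<Sum>j=1..d. real j powr (a - 1))"
    by (simp add: sum_distrib_left mult_ac)
  also have "\<dots> \<le> 3 * real d powr (a - 1) * (real d powr a / a)"
    using a by (intro mult_left_mono sum_powr_minus_le) auto
  also have "\<dots> = 3 / a * real d powr (2 * a - 1)"
    using powr_add[of "real d" "a - 1" a] by (simp add: algebra_simps)
  finally have "sum f Q \<le> 3 / a * real d powr (2 * a - 1) + 1 / a * real d powr (2 * a - 1)"
    using U split by linarith
  also have "\<dots> = 4 / a * real d powr (2 * a - 1)" by (simp add: field_simps)
  finally show ?thesis by (simp add: f_def Q_def)
qed

text \<open>By \<open>prime_dvd_fibE\<close> every prime in question belongs to \<open>Q d\<close>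
  for some divisor \<open>d\<close> of \<open>k\<close>; a union bound over \<open>d\<close>
  follows.\<close>

lemma sum_primes_dvd_fib_le:
  fixes a :: real
  assumes a: "0 < a" "a \<le> 1" and k: "k > 0"
  shows "(\<Sum>p | prime p \<and> 7 \<le> p \<and> p dvd fib k. real p powr (a - 1))
    \<le> 4 / a * (\<Sum>d | d dvd k. real d powr (2 * a - 1))"
proof -
  define Q where
    "Q d = {p. prime p \<and> 7 \<le> p \<and> p dvd fib d \<and> (d dvd p - 1 \<or> d dvd p + 1)}" for d
  have D: "finite {d. d dvd k}" "\<And>d. d dvd k \<Longrightarrow> d > 0" using k by (auto intro: Nat.gr0I)
  have finQ: "finite (Q d)" if "d dvd k" for d
    using D(2)[OF that] by (intro card_primes_dvd_fib_le(1)[of "Q d" d]) (auto simp: Q_def)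
  have "{p. prime p \<and> 7 \<le> p \<and> p dvd fib k} \<subseteq> snd ` Sigma {d. d dvd k} Q"
  proof
    fix p assume "p \<in> {p. prime p \<and> 7 \<le> p \<and> p dvd fib k}"
    then have p: "prime p" "7 \<le> p" "p dvd fib k" by auto
    obtain d where "d dvd k" "p \<in> Q d"
      using prime_dvd_fibE[OF p] p(1,2) unfolding Q_def by blast
    then show "p \<in> snd ` Sigma {d. d dvd k} Q" by (intro image_eqI[of _ _ "(d, p)"]) auto
  qed
  then have "(\<Sum>p | prime p \<and> 7 \<le> p \<and> p dvd fib k. real p powr (a - 1))
    \<le> (\<Sum>z\<in>Sigma {d. d dvd k} Q. real (snd z) powr (a - 1))"
    using D finQ by (intro sum_image_nonneg_le) auto
  also have "\<dots> = (\<Sum>d | d dvd k. \<Sum>p\<in>Q d. real p powr (a - 1))"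
    using D finQ by (subst sum.Sigma) (auto simp: split_def)
  also have "\<dots> \<le> (\<Sum>d | d dvd k. 4 / a * real d powr (2 * a - 1))"
    unfolding Q_def using a D by (intro sum_mono sum_primitive_primes_le) auto
  finally show ?thesis by (simp add: sum_distrib_left)
qed

section \<open>Divisor sums bounded through prime factors\<close>

lemma divisor_sum_powr_mult_le:
  fixes s :: real and m n :: nat
  assumes "m > 0" "n > 0"
  shows "(\<Sum>d | d dvd m * n. real d powr s) \<le>
    (\<Sum>d | d dvd m. real d powr s) * (\<Sum>d | d dvd n. real d powr s)"
proof -
  have "{d. d dvd m * n} \<subseteq> (\<lambda>(c, d). c * d) ` ({c. c dvd m} \<times> {d. d dvd n})"
  proof
    fix d assume "d \<in> {d. d dvd m * n}"
    then obtain c e where "d = c * e" "c dvd m" "e dvd n" using division_decomp[of d m n] by auto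
    then show "d \<in> (\<lambda>(c, d). c * d) ` ({c. c dvd m} \<times> {d. d dvd n})"
      by (intro image_eqI[of _ _ "(c, e)"]) auto
  qed
  then have "(\<Sum>d | d dvd m * n. real d powr s) \<le>
      (\<Sum>z\<in>{c. c dvd m} \<times> {d. d dvd n}. real (case z of (c, d) \<Rightarrow> c * d) powr s)"
    using assms by (intro sum_image_nonneg_le) auto
  also have "\<dots> = (\<Sum>c | c dvd m. \<Sum>d | d dvd n. real c powr s * real d powr s)"
    by (simp add: sum.cartesian_product powr_mult split_def)
  finally show ?thesis by (simp add: sum_product)
qed

text \<open>A geometric series whose ratio \<open>u\<close> is at most \<open>1 / sqrt 2\<close>,
  hence at most \<open>3/4\<close>, because \<open>s \<ge> 1/2\<close>; then
  \<open>u / (1 - u) \<le> 4 * u\<close>.\<close>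

lemma divisor_sum_powr_prime_power_le:
  fixes s :: real and p :: nat
  assumes p: "prime p" and s: "s \<ge> 1/2"
  shows "(\<Sum>d | d dvd p ^ e. real d powr - s) \<le> exp (4 * real p powr - s)"
proof -
  define u where "u = real p powr - s"
  have p2: "p \<ge> 2" using p by (rule prime_ge_2_nat)
  have u0: "u > 0" using p2 by (simp add: u_def)
  have "u \<le> real p powr - (1/2)" unfolding u_def using p2 s by (intro powr_mono) auto
  also have "\<dots> \<le> 2 powr - (1/2)" using p2 by (intro powr_mono2') auto
  also have "\<dots> = 1 / sqrt 2" by (simp add: powr_minus powr_half_sqrt field_simps)
  also have "\<dots> \<le> 3/4"
    using real_le_rsqrt[of "4/3" 2] by (simp add: field_simps power2_eq_square)
  finally have u34: "u \<le> 3/4" .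
  have "{d. d dvd p ^ e} \<subseteq> (\<lambda>i. p ^ i) ` {..e}"
    using p by (auto simp: divides_primepow_nat)
  then have "(\<Sum>d | d dvd p ^ e. real d powr - s) \<le> (\<Sum>i\<le>e. real (p ^ i) powr - s)"
    by (intro sum_image_nonneg_le) auto
  also have "\<dots> = (\<Sum>i\<le>e. u ^ i)"
    using p2 by (intro sum.cong) (auto simp: u_def powr_powr mult.commute simp flip: powr_realpow)
  also have "\<dots> \<le> 1 / (1 - u)"
    using u0 u34 by (subst sum_gp0) (auto intro!: divide_right_mono)
  also have "\<dots> = 1 + u / (1 - u)" using u34 by (simp add: field_simps)
  also have "\<dots> \<le> 1 + 4 * u" using u0 u34 by (simp add: field_simps)
  also have "\<dots> \<le> exp (4 * u)" by (rule exp_ge_add_one_self)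
  finally show ?thesis by (simp add: u_def)
qed

text \<open>Euler product bound, by splitting off the full power of one prime at a time.\<close>

lemma divisor_sum_powr_le:
  fixes s :: real and k :: nat
  assumes s: "s \<ge> 1/2" and k: "k > 0"
  shows "(\<Sum>d | d dvd k. real d powr - s) \<le> exp (4 * (\<Sum>q\<in>prime_factors k. real q powr - s))"
  using k
proof (induction k rule: less_induct)
  case (less k)
  show ?case
  proof (cases "k = 1")
    case False
    then obtain p where p: "prime p" "p dvd k" using prime_factor_nat by blast
    obtain m where m: "k = p ^ multiplicity p k * m" "\<not> p dvd m"
      using multiplicity_decompose'[of k p] less.prems p(1) by (metis not_prime_unit not_gr0)
    define e where "e = multiplicity p k"
    have e: "e > 0" using p less.prems by (simp add: e_def prime_multiplicity_gt_zero_iff)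
    have m0: "m > 0" using m less.prems by (auto intro: Nat.gr0I)
    have p2: "p \<ge> 2" using p(1) by (rule prime_ge_2_nat)
    have km: "k = p ^ e * m" using m by (simp add: e_def)
    have "p ^ e > 1" using p2 e by (intro one_less_power) auto
    then have mk: "m < k" using km m0 by simp
    have pf: "prime_factors k = insert p (prime_factors m)"
      using p(1) e m0 p2 by (simp add: km prime_factors_product prime_factors_power prime_prime_factors)
    have "p \<notin> prime_factors m" using m by auto
    have "(\<Sum>d | d dvd k. real d powr - s) \<le>
        (\<Sum>d | d dvd p ^ e. real d powr - s) * (\<Sum>d | d dvd m. real d powr - s)"
      unfolding km using m0 p2 by (intro divisor_sum_powr_mult_le) auto
    also have "\<dots> \<le> exp (4 * real p powr - s) * exp (4 * (\<Sum>q\<in>prime_factors m. real q powr - s))"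
      using p s less.IH[OF mk m0]
      by (intro mult_mono divisor_sum_powr_prime_power_le) (auto intro!: sum_nonneg)
    also have "\<dots> = exp (4 * (\<Sum>q\<in>prime_factors k. real q powr - s))"
      using \<open>p \<notin> prime_factors m\<close> by (simp add: pf exp_add[symmetric] algebra_simps)
    finally show ?thesis .
  qed simp
qed

text \<open>Split at \<open>y = ln x\<close>. For \<open>q \<le> y\<close>, replacing
  \<open>q powr \<eta>\<close> by \<open>y powr \<eta>\<close> leaves reciprocals of primes; above
  \<open>y\<close> there are at most \<open>2 * y\<close> prime factors as \<open>k \<le> x\<close>.
  The constant is \<open>5/2 + 2\<close>.\<close>

lemma sum_prime_factors_powr_le:
  fixes x \<eta> :: real
  assumes k: "k > 0" "real k \<le> x" and x: "ln x > 0" and J: "J > 0" "ln x \<le> 2 ^ J"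
    and \<eta>: "0 \<le> \<eta>" "\<eta> \<le> 1"
  shows "(\<Sum>q\<in>prime_factors k. real q powr (\<eta> - 1)) \<le> ln x powr \<eta> * (9/2 + 2 * ln (real J))"
proof -
  define y where "y = ln x"
  have y: "y > 0" using x by (simp add: y_def)
  define L U where "L = {q \<in> prime_factors k. real q \<le> y}" and "U = {q \<in> prime_factors k. real q > y}"
  have "(\<Sum>q\<in>L. real q powr (\<eta> - 1)) \<le> (\<Sum>q\<in>L. y powr \<eta> * (1 / real q))"
  proof (rule sum_mono)
    fix q assume "q \<in> L"
    then have q: "real q \<le> y" "q > 0" by (auto simp: L_def prime_gt_0_nat in_prime_factors_iff)
    then have "real q powr \<eta> / real q \<le> y powr \<eta> / real q"
      using \<eta> by (intro divide_right_mono powr_mono2) auto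
    then show "real q powr (\<eta> - 1) \<le> y powr \<eta> * (1 / real q)" using q by (simp add: powr_diff)
  qed
  also have "\<dots> = y powr \<eta> * (\<Sum>q\<in>L. 1 / real q)" by (simp add: sum_distrib_left)
  also have "\<dots> \<le> y powr \<eta> * (\<Sum>q | prime q \<and> q \<le> (2::nat) ^ J. 1 / real q)"
  proof (rule mult_left_mono[OF sum_mono2])
    show "finite {q. prime q \<and> q \<le> (2::nat) ^ J}" by (rule finite_subset[of _ "{..2 ^ J}"]) auto
    show "L \<subseteq> {q. prime q \<and> q \<le> 2 ^ J}"
    proof
      fix q assume "q \<in> L"
      then have "prime q" "real q \<le> ln x" by (auto simp: L_def y_def)
      moreover from this have "real q \<le> 2 ^ J" using J(2) by linarith
      ultimately show "q \<in> {q. prime q \<and> q \<le> 2 ^ J}" by simp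
    qed
  qed auto
  also have "\<dots> \<le> y powr \<eta> * (5/2 + 2 * ln (real J))"
    using J(1) by (intro mult_left_mono sum_inverse_primes_le) auto
  finally have L: "(\<Sum>q\<in>L. real q powr (\<eta> - 1)) \<le> y powr \<eta> * (5/2 + 2 * ln (real J))" .
  have "(\<Sum>q\<in>U. real q powr (\<eta> - 1)) \<le> real (card U) * y powr (\<eta> - 1)"
  proof (rule sum_bounded_above)
    fix q assume "q \<in> U"
    then show "real q powr (\<eta> - 1) \<le> y powr (\<eta> - 1)"
      using \<eta> y by (intro powr_mono2') (auto simp: U_def)
  qed
  also have "\<dots> \<le> 2 * y * y powr (\<eta> - 1)"
  proof (rule mult_right_mono)
    have "2 ^ card U \<le> k"
      using k by (intro power_card_primes_le) (auto simp: U_def prime_ge_2_nat in_prime_factors_iff)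
    then have "real (2 ^ card U) \<le> real k" by (rule of_nat_mono)
    moreover have "real (2 ^ card U) = 2 ^ card U" by simp
    ultimately have "(2::real) ^ card U \<le> x" using k by linarith
    then have "ln (2 ^ card U) \<le> y" using k unfolding y_def by (intro ln_mono) auto
    then have "real (card U) * ln 2 \<le> y" by (simp add: ln_realpow)
    moreover have "real (card U) * (1/2) \<le> real (card U) * ln 2"
      using ln_le_minus_one[of "1/2 :: real"] by (intro mult_left_mono) (auto simp: ln_div)
    ultimately show "real (card U) \<le> 2 * y" by linarith
  qed simp
  also have "\<dots> = y powr \<eta> * 2" using y by (simp add: powr_diff)
  finally have U: "(\<Sum>q\<in>U. real q powr (\<eta> - 1)) \<le> y powr \<eta> * 2" .
  have "(\<Sum>q\<in>prime_factors k. real q powr (\<eta> - 1)) = (\<Sum>q\<in>L \<union> U. real q powr (\<eta> - 1))"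
    by (intro sum.cong) (auto simp: L_def U_def)
  also have "\<dots> = (\<Sum>q\<in>L. real q powr (\<eta> - 1)) + (\<Sum>q\<in>U. real q powr (\<eta> - 1))"
    by (intro sum.union_disjoint) (auto simp: L_def U_def)
  also have "\<dots> \<le> y powr \<eta> * (5/2 + 2 * ln (real J)) + y powr \<eta> * 2" using L U by linarith
  finally show ?thesis by (simp add: y_def algebra_simps)
qed

text \<open>Chains the preceding bounds with \<open>s = 1 - 2 * a\<close> and
  \<open>\<eta> = 2 * a\<close>; \<open>a \<le> 1/4\<close> ensures
  \<open>s \<ge> 1/2\<close>.\<close>

lemma sum_fib_cofactors_explicit_le:
  fixes x a :: real
  assumes k: "k > 0" "real k \<le> x" and x: "ln x > 0" and J: "J > 0" "ln x \<le> 2 ^ J"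
    and a: "0 < a" "a \<le> 1/4"
  shows "(\<Sum>m\<in>fib_cofactors k. real m powr (a - 1)) \<le>
    exp (4 / a * exp (4 * (ln x powr (2 * a) * (9/2 + 2 * ln (real J)))))"
proof -
  have "(\<Sum>m\<in>fib_cofactors k. real m powr (a - 1)) \<le>
      exp (\<Sum>p | prime p \<and> 7 \<le> p \<and> p dvd fib k. real p powr (a - 1))"
    using sum_fib_cofactors_le[OF k(1), of "1 - a"] by simp
  also have "\<dots> \<le> exp (4 / a * (\<Sum>d | d dvd k. real d powr (2 * a - 1)))"
    using a k by (intro iffD2[OF exp_le_cancel_iff] sum_primes_dvd_fib_le) auto
  also have "\<dots> \<le> exp (4 / a * exp (4 * (\<Sum>q\<in>prime_factors k. real q powr (2 * a - 1))))"
    using a divisor_sum_powr_le[of "1 - 2 * a", OF _ k(1)]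
    by (intro iffD2[OF exp_le_cancel_iff] mult_left_mono) auto
  also have "\<dots> \<le> exp (4 / a * exp (4 * (ln x powr (2 * a) * (9/2 + 2 * ln (real J)))))"
    using a sum_prime_factors_powr_le[OF k x J, of "2 * a"]
    by (intro iffD2[OF exp_le_cancel_iff] mult_left_mono) auto
  finally show ?thesis .
qed

section \<open>Counting indices that divide their Fibonacci number\<close>

lemma square_part_le:
  fixes n :: nat
  assumes "n > 0"
  shows "square_part n \<le> n"
proof -
  have "square_part n dvd n"
    using square_part_square_dvd[of n] by (metis dvd_mult_left power2_eq_square)
  then show ?thesis using assms by (rule dvd_imp_le)
qed

lemma sum_inverse_squares_tail_le:
  assumes "V > 0" "V \<le> N"
  shows "(\<Sum>v\<in>{V<..N}. 1 / (real v)\<^sup>2) \<le> 1 / real V - 1 / real N"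
  using assms(2)
proof (induction N rule: dec_induct)
  case (step N)
  have "{V<..Suc N} = insert (Suc N) {V<..N}" using step by auto
  moreover have "1 / (real (Suc N))\<^sup>2 \<le> 1 / real N - 1 / real (Suc N)"
  proof -
    have N: "N > 0" using step assms(1) by simp
    then have "real N * real (Suc N) \<le> real (Suc N) * real (Suc N)"
      by (intro mult_right_mono) auto
    then have "1 / (real (Suc N))\<^sup>2 \<le> 1 / (real N * real (Suc N))"
      unfolding power2_eq_square using N by (intro divide_left_mono) auto
    also have "\<dots> = 1 / real N - 1 / real (Suc N)" using N by (simp add: field_simps)
    finally show ?thesis .
  qed
  ultimately show ?case using step.IH by simp
qed simp

text \<open>At most \<open>N / v\<^sup>2\<close> numbers up to \<open>N\<close> are multiples of
  \<open>v\<^sup>2\<close>; the tail over \<open>v > V\<close> telescopes to at most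
  \<open>1 / V\<close>.\<close>

lemma card_large_square_part_le:
  assumes "V > 0"
  shows "real (card {n. 1 \<le> n \<and> n \<le> N \<and> V < square_part n}) \<le> real N / real V"
proof (cases "V \<le> N")
  case True
  define M where "M v = {n. 1 \<le> n \<and> n \<le> N \<and> v\<^sup>2 dvd n}" for v :: nat
  have "{n. 1 \<le> n \<and> n \<le> N \<and> V < square_part n} \<subseteq> (\<Union>v\<in>{V<..N}. M v)"
  proof
    fix n assume "n \<in> {n. 1 \<le> n \<and> n \<le> N \<and> V < square_part n}"
    then have "n \<in> M (square_part n)" "square_part n \<in> {V<..N}"
      using square_part_le[of n] by (auto simp: M_def)
    then show "n \<in> (\<Union>v\<in>{V<..N}. M v)" by blast
  qed
  moreover have finM: "finite (M v)" for v
    by (rule finite_subset[of _ "{..N}"]) (auto simp: M_def)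
  ultimately have "card {n. 1 \<le> n \<and> n \<le> N \<and> V < square_part n} \<le> card (\<Union>v\<in>{V<..N}. M v)"
    by (intro card_mono) auto
  also have "\<dots> \<le> (\<Sum>v\<in>{V<..N}. card (M v))" by (rule card_UN_le) simp
  finally have "real (card {n. 1 \<le> n \<and> n \<le> N \<and> V < square_part n}) \<le> (\<Sum>v\<in>{V<..N}. real (card (M v)))"
    by (metis of_nat_le_iff of_nat_sum)
  also have "\<dots> \<le> (\<Sum>v\<in>{V<..N}. real N * (1 / (real v)\<^sup>2))"
  proof (rule sum_mono)
    fix v assume "v \<in> {V<..N}"
    then have v: "v\<^sup>2 > 0" by simp
    have "M v \<subseteq> (\<lambda>j. v\<^sup>2 * j) ` {1..N div v\<^sup>2}"
    proof
      fix n assume n: "n \<in> M v"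
      then obtain j where j: "n = v\<^sup>2 * j" by (auto simp: M_def)
      then have "j \<in> {1..N div v\<^sup>2}"
        using n v by (auto simp: M_def less_eq_div_iff_mult_less_eq mult.commute intro: Nat.gr0I)
      then show "n \<in> (\<lambda>j. v\<^sup>2 * j) ` {1..N div v\<^sup>2}" using j by blast
    qed
    then have "card (M v) \<le> card {1..N div v\<^sup>2}" by (rule surj_card_le[rotated]) simp
    then have "real (card (M v)) \<le> real (N div v\<^sup>2)" by simp
    also have "\<dots> \<le> real N / real (v\<^sup>2)" by (rule of_nat_div_le_of_nat)
    finally show "real (card (M v)) \<le> real N * (1 / (real v)\<^sup>2)" by simp
  qed
  also have "\<dots> = real N * (\<Sum>v\<in>{V<..N}. 1 / (real v)\<^sup>2)" by (simp add: sum_distrib_left)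
  also have "\<dots> \<le> real N * (1 / real V)"
    using sum_inverse_squares_tail_le[OF assms True]
    by (intro mult_left_mono) (auto intro: order_trans)
  finally show ?thesis by simp
next
  case False
  have empty: "{n. 1 \<le> n \<and> n \<le> N \<and> V < square_part n} = {}"
  proof (rule equals0I)
    fix n assume "n \<in> {n. 1 \<le> n \<and> n \<le> N \<and> V < square_part n}"
    then show False using False square_part_le[of n] by auto
  qed
  show ?thesis unfolding empty by simp
qed

text \<open>The first term counts the \<open>n\<close> with square part above \<open>V\<close>. The
  others lie in towers of height \<open>T\<close> over bases \<open>b \<le> 30 * V ^ 3\<close>;
  summing \<open>b powr (a - 1)\<close> over the bases yields the factor with
  \<open>powr a / a\<close>.\<close>

lemma fibA_le:
  fixes x a :: real
  assumes x: "ln x > 0" "x > 0" and J: "J > 0" "ln x \<le> 2 ^ J" and a: "0 < a" "a \<le> 1/4"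
    and V: "V > 0" and T: "2 * sqrt (ln x) \<le> real T"
  shows "real (fibA x) \<le> x / real V + x powr (1 - a) * ((30 * real V ^ 3) powr a / a) *
    exp (4 / a * exp (4 * (ln x powr (2 * a) * (9/2 + 2 * ln (real J))))) ^ T"
proof -
  define E where "E = exp (4 / a * exp (4 * (ln x powr (2 * a) * (9/2 + 2 * ln (real J)))))"
  define N where "N = nat \<lfloor>x\<rfloor>"
  have le_N: "n \<le> N \<longleftrightarrow> real n \<le> x" for n
    using x(2) by (simp add: N_def le_nat_iff le_floor_iff)
  define S where "S = {n. 1 \<le> n \<and> real n \<le> x \<and> n dvd fib n}"
  define S1 where "S1 = {n. 1 \<le> n \<and> n \<le> N \<and> V < square_part n}"
  define W where "W b = {n. n \<in> fib_tower b T \<and> n \<le> N}" for b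
  have fin: "finite S1" "finite (W b)" for b
    by (rule finite_subset[of _ "{..N}"]; auto simp: S1_def W_def)+
  have "S \<subseteq> S1 \<union> (\<Union>b\<in>{1..30 * V ^ 3}. W b)"
  proof
    fix n assume "n \<in> S"
    then have n: "n > 0" "real n \<le> x" "n dvd fib n" by (auto simp: S_def)
    show "n \<in> S1 \<union> (\<Union>b\<in>{1..30 * V ^ 3}. W b)"
    proof (cases "V < square_part n")
      case True
      then show ?thesis using n by (simp add: S1_def le_N)
    next
      case False
      obtain b t where b: "b > 0" "b \<le> 30 * square_part n ^ 3" "n \<in> fib_tower b t"
          and t: "2 ^ (t\<^sup>2) \<le> n\<^sup>2"
        using self_fib_divisor_mem_tower[OF n(1,3)] by blast
      have "square_part n ^ 3 \<le> V ^ 3" using False by (intro power_mono) auto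
      then have "b \<le> 30 * V ^ 3" using b(2) by linarith
      then have bV: "b \<in> {1..30 * V ^ 3}" using b(1) by simp
      have "real (2 ^ (t\<^sup>2)) \<le> real (n\<^sup>2)" using t by (rule of_nat_mono)
      then have "(2::real) ^ (t\<^sup>2) \<le> (real n)\<^sup>2" by simp
      also have "\<dots> \<le> x\<^sup>2" using n by (intro power_mono) auto
      finally have "ln ((2::real) ^ (t\<^sup>2)) \<le> ln (x\<^sup>2)" using x by (intro ln_mono) auto
      then have "real (t\<^sup>2) * ln 2 \<le> 2 * ln x"
        using x by (simp add: ln_realpow)
      \<comment> \<open>Using \<open>ln 2 \<ge> 1/2\<close>, the height satisfies
        \<open>t\<^sup>2 \<le> 4 * ln x\<close>, which is the condition imposed on
        \<open>T\<close>.\<close>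
      moreover have "real (t\<^sup>2) * (1/2) \<le> real (t\<^sup>2) * ln 2"
        using ln_le_minus_one[of "1/2 :: real"] by (intro mult_left_mono) (auto simp: ln_div)
      ultimately have "(real t)\<^sup>2 \<le> (2 * sqrt (ln x))\<^sup>2" using x by (simp add: power_mult_distrib)
      then have "real t \<le> 2 * sqrt (ln x)" by (rule power2_le_imp_le) (use x in simp)
      then have "t \<le> T" using T by linarith
      then have "n \<in> W b" using fib_tower_mono b(3) n by (auto simp: W_def le_N)
      then show ?thesis using bV by blast
    qed
  qed
  then have "card S \<le> card (S1 \<union> (\<Union>b\<in>{1..30 * V ^ 3}. W b))"
    using fin by (intro card_mono) auto
  also have "\<dots> \<le> card S1 + (\<Sum>b=1..30 * V ^ 3. card (W b))"
    by (rule order_trans[OF card_Un_le add_left_mono[OF card_UN_le]]) simp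
  finally have "real (card S) \<le> real (card S1) + (\<Sum>b=1..30 * V ^ 3. real (card (W b)))"
    by (metis of_nat_add of_nat_le_iff of_nat_sum)
  moreover have "real (card S1) \<le> x / real V"
  proof -
    have "real (card S1) \<le> real N / real V" unfolding S1_def using V by (rule card_large_square_part_le)
    also have "\<dots> \<le> x / real V" using le_N[of N] by (intro divide_right_mono) auto
    finally show ?thesis .
  qed
  moreover have "(\<Sum>b=1..30 * V ^ 3. real (card (W b))) \<le>
      (\<Sum>b=1..30 * V ^ 3. x powr (1 - a) * E ^ T * real b powr (a - 1))"
  proof (rule sum_mono)
    fix b assume "b \<in> {1..30 * V ^ 3}"
    then have b: "b > 0" by simp
    have "real (card (W b)) = (\<Sum>n\<in>W b. 1)" by simp
    \<comment> \<open>Rankin's trick: the weight \<open>(x / n) powr (1 - a)\<close> is at least 1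
      for \<open>n \<le> x\<close>.\<close>
    also have "\<dots> \<le> (\<Sum>n\<in>W b. x powr (1 - a) * real n powr - (1 - a))"
    proof (rule sum_mono)
      fix n assume "n \<in> W b"
      then have n: "n > 0" "real n \<le> x" using fib_tower_pos[OF b] by (auto simp: W_def le_N)
      have "1 = real n powr (1 - a) * real n powr - (1 - a)"
        using n by (simp flip: powr_add)
      also have "\<dots> \<le> x powr (1 - a) * real n powr - (1 - a)"
        using n a by (intro mult_right_mono powr_mono2) auto
      finally show "1 \<le> x powr (1 - a) * real n powr - (1 - a)" .
    qed
    also have "\<dots> = x powr (1 - a) * (\<Sum>n\<in>W b. real n powr - (1 - a))"
      by (simp add: sum_distrib_left)
    also have "\<dots> \<le> x powr (1 - a) * (real b powr - (1 - a) * E ^ T)"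
    proof (rule mult_left_mono)
      show "(\<Sum>n\<in>W b. real n powr - (1 - a)) \<le> real b powr - (1 - a) * E ^ T"
        unfolding W_def
      proof (rule sum_fib_tower_le[OF b])
        show "E \<ge> 0" by (simp add: E_def)
        show "(\<Sum>m\<in>fib_cofactors k. real m powr - (1 - a)) \<le> E" if "k > 0" "k \<le> N" for k
          using sum_fib_cofactors_explicit_le[OF that(1) _ x(1) J a] that(2) by (simp add: le_N E_def)
      qed
    qed simp
    finally show "real (card (W b)) \<le> x powr (1 - a) * E ^ T * real b powr (a - 1)"
      by (simp add: mult_ac)
  qed
  moreover have "(\<Sum>b=1..30 * V ^ 3. x powr (1 - a) * E ^ T * real b powr (a - 1)) \<le>
      x powr (1 - a) * E ^ T * (real (30 * V ^ 3) powr a / a)"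
    unfolding sum_distrib_left[symmetric]
    using a by (intro mult_left_mono sum_powr_minus_le) (auto simp: E_def)
  moreover have "fibA x = card S" by (simp add: fibA_def S_def)
  ultimately show ?thesis by (simp add: E_def mult_ac)
qed

section \<open>Choice of the parameters and the limit\<close>

text \<open>
  Here \<open>w = ln (ln x)\<close>. The correction \<open>- 2 * ln (ln w)\<close> makes \<open>ln x powr (2 * a) = w / (ln w)\<^sup>2\<close>, which
  stays \<open>o(w)\<close> after multiplication by the sum of \<open>1 / q\<close> over the primes \<open>q \<le> ln x\<close>.
\<close>
definition rankin_gain :: "real \<Rightarrow> real" where
  "rankin_gain w = (ln w - 2 * ln (ln w)) / (2 * w)"

text \<open>Bounds the logarithm of what accompanies \<open>x powr (1 - a)\<close> in
  \<open>fibA_le\<close>: first the bases, with \<open>V \<le> 2 * exp H\<close> and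
  \<open>240 = 30 * 2 ^ 3\<close>, then the factor \<open>1 / a\<close>, then
  \<open>T \<le> 3 * exp (w / 2)\<close> steps. The \<open>17/2\<close> is
  \<open>9/2 + 2 * 2\<close>, from \<open>ln J \<le> 2 + ln w\<close>.\<close>

definition rankin_error :: "real \<Rightarrow> real" where
  "rankin_error w = rankin_gain w * (ln 240 + 3 * (exp w * ln w / w)) - ln (rankin_gain w)
     + 3 * exp (w / 2) * (4 / rankin_gain w * exp (4 * (w / (ln w)\<^sup>2 * (17/2 + 2 * ln w))))"

text \<open>Substitutes \<open>x = exp (exp w)\<close>. The choice of \<open>H\<close> balances two
  needs: \<open>a \<le> ln w / w\<close> makes the discarded \<open>x / V\<close> small enough,
  while \<open>3 * a * H\<close> is still of smaller order than \<open>a * ln x\<close>. The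
  \<open>ln 2\<close> comes from adding two equal bounds.\<close>

lemma fibA_exp_exp_le:
  fixes w :: real
  assumes w: "w \<ge> 1" "ln w > 0" and a: "0 < rankin_gain w" "rankin_gain w \<le> 1/4" "rankin_gain w \<le> ln w / w"
  shows "real (fibA (exp (exp w))) \<le> exp (exp w * (1 - rankin_gain w) + rankin_error w + ln 2)"
proof -
  define a where "a = rankin_gain w"
  define H where "H = exp w * ln w / w"
  define V where "V = nat \<lceil>exp H\<rceil>"
  define T where "T = nat \<lceil>2 * exp (w / 2)\<rceil>"
  define J where "J = nat \<lceil>w / ln 2\<rceil>"
  define G where "G = 4 * (w / (ln w)\<^sup>2 * (17/2 + 2 * ln w))"
  have R: "rankin_error w = a * (ln 240 + 3 * H) - ln a + 3 * exp (w / 2) * (4 / a * exp G)"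
    by (simp add: rankin_error_def a_def H_def G_def)
  note a = a[folded a_def]
  have H0: "H \<ge> 0" using w by (simp add: H_def)
  have ln2: "ln 2 \<ge> (1/2 :: real)"
    using ln_le_minus_one[of "1/2 :: real"] by (simp add: ln_div)
  have sqrt: "sqrt (exp w) = exp (w / 2)"
    by (rule real_sqrt_unique) (auto simp flip: exp_double)
  have nat_ceil: "y \<le> real (nat \<lceil>y\<rceil>)" "real (nat \<lceil>y\<rceil>) \<le> y + 1" if "y \<ge> 0" for y :: real
    using that of_int_ceiling_le_add_one[of y] of_nat_ceiling[of y] by simp_all
  have V: "exp H \<le> real V" "real V \<le> 2 * exp H"
    using nat_ceil[of "exp H"] one_le_exp_iff[of H] H0 unfolding V_def by linarith+
  have V0: "V > 0" using V(1) exp_gt_zero[of H] by (metis gr0I not_less of_nat_0)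
  have T: "2 * exp (w / 2) \<le> real T" "real T \<le> 3 * exp (w / 2)"
    using nat_ceil[of "2 * exp (w / 2)"] one_le_exp_iff[of "w / 2"] w unfolding T_def by linarith+
  have J: "w / ln 2 \<le> real J" "real J \<le> w / ln 2 + 1"
    using nat_ceil[of "w / ln 2"] w by (auto simp: J_def)
  have J': "real J \<le> 3 * w"
  proof -
    have "w / ln 2 \<le> w / (1/2)" using ln2 w by (intro divide_left_mono) auto
    then show ?thesis using J(2) w by simp
  qed
  have "0 < w / ln 2" using w by simp
  then have J0: "J > 0" using J(1) by (metis gr0I not_less of_nat_0)
  have expw: "exp w \<le> 2 ^ J"
  proof -
    have "w \<le> real J * ln 2" using J(1) ln2 by (simp add: field_simps)
    then have "exp w \<le> exp (real J * ln 2)" by simp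
    also have "\<dots> = 2 ^ J" by (simp add: exp_of_nat_mult)
    finally show ?thesis .
  qed
  have lnJ: "ln (real J) \<le> 2 + ln w"
  proof -
    have "ln (real J) \<le> ln (3 * w)" using J' J0 by (intro ln_mono) auto
    also have "\<dots> = ln 3 + ln w" using w by (simp add: ln_mult)
    also have "ln 3 \<le> (2 :: real)" using ln_le_minus_one[of "3 :: real"] by simp
    finally show ?thesis by simp
  qed
  have y2a: "exp w powr (2 * a) = w / (ln w)\<^sup>2"
  proof -
    have "exp w powr (2 * a) = exp (ln w - 2 * ln (ln w))"
      using w by (simp add: powr_def a_def rankin_gain_def field_simps)
    also have "\<dots> = w / exp (ln (ln w) * 2)"
      using w by (simp add: exp_diff mult.commute)
    also have "exp (ln (ln w) * 2) = (ln w)\<^sup>2"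
      using w by (simp add: exp_double mult.commute)
    finally show ?thesis .
  qed
  define E where "E = exp (4 / a * exp (4 * (exp w powr (2 * a) * (9/2 + 2 * ln (real J)))))"
  have E: "E ^ T \<le> exp (3 * exp (w / 2) * (4 / a * exp G))"
  proof -
    have "E \<le> exp (4 / a * exp G)"
      unfolding E_def y2a G_def using a(1) lnJ w
      by (intro iffD2[OF exp_le_cancel_iff] mult_left_mono) auto
    then have "E ^ T \<le> exp (4 / a * exp G) ^ T" by (intro power_mono) (auto simp: E_def)
    also have "\<dots> = exp (real T * (4 / a * exp G))" by (rule exp_of_nat_mult[symmetric])
    also have "\<dots> \<le> exp (3 * exp (w / 2) * (4 / a * exp G))"
      using T a(1) by (intro iffD2[OF exp_le_cancel_iff] mult_right_mono) auto
    finally show ?thesis .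
  qed
  have B: "(30 * real V ^ 3) powr a / a \<le> exp (a * (ln 240 + 3 * H) - ln a)"
  proof -
    have "real V ^ 3 \<le> (2 * exp H) ^ 3" using V by (intro power_mono) auto
    also have "\<dots> = 8 * exp (3 * H)" by (simp add: power_mult_distrib exp_of_nat_mult[of 3 H, simplified])
    finally have "(30 * real V ^ 3) powr a \<le> (240 * exp (3 * H)) powr a"
      using a(1) by (intro powr_mono2) auto
    also have "\<dots> = exp (a * (ln 240 + 3 * H))" by (simp add: powr_def ln_mult)
    finally have "(30 * real V ^ 3) powr a / a \<le> exp (a * (ln 240 + 3 * H)) / a"
      using a(1) by (intro divide_right_mono) auto
    then show ?thesis using a(1) by (simp add: exp_diff)
  qed
  have "x / real V \<le> x / exp H" if "x > 0" for x :: real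
    using V V0 that by (intro divide_left_mono) auto
  then have "exp (exp w) / real V \<le> exp (exp w - H)" by (simp add: exp_diff)
  also have "\<dots> \<le> exp (exp w * (1 - a) + rankin_error w)"
  proof -
    have "exp w * a \<le> exp w * (ln w / w)" using a(3) by (intro mult_left_mono) auto
    then have "exp w * a \<le> H" by (simp add: H_def)
    moreover have "rankin_error w \<ge> 0"
      unfolding R using a H0 by (intro add_nonneg_nonneg) (auto intro: order_trans[of _ 0])
    ultimately show ?thesis by (simp add: right_diff_distrib)
  qed
  finally have 1: "exp (exp w) / real V \<le> exp (exp w * (1 - a) + rankin_error w)" .
  have "exp (exp w) powr (1 - a) * ((30 * real V ^ 3) powr a / a) * E ^ T \<le>
    exp (exp w * (1 - a)) * exp (a * (ln 240 + 3 * H) - ln a) * exp (3 * exp (w / 2) * (4 / a * exp G))"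
    using B E a(1) by (intro mult_mono) (auto simp: powr_def mult.commute E_def)
  also have "\<dots> = exp (exp w * (1 - a) + rankin_error w)"
    by (simp add: R flip: exp_add)
  finally have 2: "exp (exp w) powr (1 - a) * ((30 * real V ^ 3) powr a / a) * E ^ T \<le>
    exp (exp w * (1 - a) + rankin_error w)" .
  have "real (fibA (exp (exp w))) \<le>
      exp (exp w) / real V + exp (exp w) powr (1 - a) * ((30 * real V ^ 3) powr a / a) * E ^ T"
    using fibA_le[of "exp (exp w)" J a V T] J0 expw a V0 T(1) by (simp add: sqrt E_def)
  also have "\<dots> \<le> 2 * exp (exp w * (1 - a) + rankin_error w)" using 1 2 by linarith
  also have "\<dots> = exp (exp w * (1 - a) + rankin_error w + ln 2)" by (simp add: exp_add)
  finally show ?thesis by (simp add: a_def)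
qed

theorem theorem1p2:
  shows "\<exists>\<epsilon>::real \<Rightarrow> real. (\<epsilon> \<longlongrightarrow> 0) at_top \<and>
    (\<forall>\<^sub>F x in at_top. real (fibA x) \<le>
       x powr (1 - (1/2 + \<epsilon> x) * ln (ln (ln x)) / ln (ln x)))"
proof -
  \<comment> \<open>Chosen so that the exponent in the theorem equals the one in
    \<open>fibA_exp_exp_le\<close>.\<close>
  define e where
    "e w = (rankin_gain w * exp w - rankin_error w - ln 2) * w / (exp w * ln w) - 1/2" for w
  \<comment> \<open>The gain is asymptotic to \<open>ln w / (2 * w)\<close>, the source of
    \<open>1/2\<close>. The inner exponent in the error is about \<open>8 * w / ln w\<close>, so the
    last term is \<open>exp (w / 2 + o(w))\<close>, negligible against
    \<open>exp w * ln w / w\<close>.\<close>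
  have lim: "(e \<longlongrightarrow> 0) at_top"
    unfolding e_def rankin_error_def rankin_gain_def by real_asymp
  have conds: "\<forall>\<^sub>F w in at_top. w \<ge> 1 \<and> ln w > 0 \<and> 0 < rankin_gain w \<and> rankin_gain w \<le> 1/4 \<and>
      rankin_gain w \<le> ln w / w"
    unfolding rankin_gain_def by (intro eventually_conj; real_asymp)
  have bound: "\<forall>\<^sub>F w in at_top. real (fibA (exp (exp w))) \<le>
      exp (exp w) powr (1 - (1/2 + e w) * ln w / w)"
    using conds
  proof eventually_elim
    case (elim w)
    have "(1/2 + e w) * ln w / w * exp w = rankin_gain w * exp w - rankin_error w - ln 2"
      using elim by (auto simp: e_def)
    then have "exp w * (1 - rankin_gain w) + rankin_error w + ln 2 =
        (1 - (1/2 + e w) * ln w / w) * exp w"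
      by (simp add: algebra_simps)
    then show ?case using fibA_exp_exp_le[of w] elim by (simp add: powr_def)
  qed
  have loglog: "filterlim (\<lambda>x::real. ln (ln x)) at_top at_top" by real_asymp
  have "((\<lambda>x. e (ln (ln x))) \<longlongrightarrow> 0) at_top" by (rule filterlim_compose[OF lim loglog])
  moreover have "\<forall>\<^sub>F x in at_top. real (fibA x) \<le>
       x powr (1 - (1/2 + e (ln (ln x))) * ln (ln (ln x)) / ln (ln x))"
    using eventually_compose_filterlim[OF bound loglog] eventually_gt_at_top[of 1]
    by eventually_elim simp
  ultimately show ?thesis by (intro exI[of _ "\<lambda>x. e (ln (ln x))"] conjI)
qed

end
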